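(* For $s\subseteq N$ let $\Delta(s):=V(s)-\sum_{i\in s}V(\{i\})$. Let $s\subseteq N$ with $\Delta(s)\ge0$ and $V(\{i\})\ge0$ for all $i\in s$. Then, for every group $g\in G$, the lifted stability cut $$\sum_{i\in s}v_i\ \ge\ \Delta(s)\Bigl(\sum_{i\in s}z_{ig}-|s|+1\Bigr)+\sum_{i\in s}V(\{i\})\,z_{ig}$$ is valid for (i.e. satisfied by) every mixed-integer point of $\mathcal F^{\mathrm{stab}}$.
   Context: **Game.** $N=\{1,\dots,n\}$ is a finite player set, $R$ a finite item set, $I_j\subseteq N$ the set of players for whom item $j$ is available, $R_i=\{j\in R:i\in I_j\}$. Data: profits $p^i_j\ge0$, weights $a_j>0$, budgets $b^i$, capacities $u^i_j\ge 0$, private constraints $B^ix^i\le d^i$, and a pooling parameter $\alpha\in(0,1]$. For a coalition $c\subseteq N$ let $I^c_j=I_j\cap c$, $R^c=\{j:I^c_j\ne\emptyset\}$, $R^c_{\mathrm{ind}}=\{j\in R^c:|I^c_j|=1\}$, $R^c_{\mathrm{com}}=\{j\in R^c:|I^c_j|\ge2\}$. With variables $x^i=(x^i_j)_{j\in R_i}$ for $i\in c$ and $y^c_j$ for $j\in R^c_{\mathrm{com}}$, $V(c)$ is the maximum of $\sum_{j\in R^c}\sum_{i\in I^c_j}p^i_jx^i_j$ subject to: $\sum_{j\in R^c_{\mathrm{com}}}a_jy^c_j+\sum_{j\in R^c_{\mathrm{ind}}}\sum_{i\in I^c_j}a_jx^i_j\le\sum_{i\in c}b^i$; $y^c_j=\sum_{i\in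 I^c_j}x^i_j$ for $j\in R^c_{\mathrm{com}}$; $B^ix^i\le d^i$ for $i\in c$; $0\le x^i_j\le u^i_j$; $0\le y^c_j\le\alpha\sum_{i\in I^c_j}u^i_j$ and $y^c_j\in\mathbb Z_+$ for $j\in R^c_{\mathrm{com}}$; $x^i_j\in\mathbb Z_+$ for $j\in R^c_{\mathrm{ind}}$ (the $x^i_j$ with $j\in R^c_{\mathrm{com}}$ are continuous). $V(\emptyset)=0$. Standing assumptions: every such program is feasible and bounded, the zero plan is feasible for every program, and the private constraints do not tie a member's common items to its other decisions. **The sets $\mathcal F$ and $\mathcal F^{\mathrm{stab}}$.** Let $G:=N$ index groups. $\mathcal F$ is the set of mixed-integer points with variables $v_i$, $z_{ig}$, $x^{i,g}_j$ ($j\in R$, $i\in I_j$), $y^g_j$, $\pi_g$, and auxiliary $\phi_{ig}$ (and $w^g_j$ if $\alpha<1$) satisfying, for all $i\in N$, $g\in G$, $j\in R$: (1) $\sum_{g\in G}z_{ig}=1$; (2) $\pi_g=\sum_{j\in R}\sum_{i\in I_j}p^i_jx^{i,g}_j=\sum_{i\in N}\phi_{ig}$; (3) $\phi_{ig}\le v_i$, $\phi_{ig}\le Mz_{ig}$, $\phi_{ig}\ge v_i-M(1-z_{ig})$, $\phi_{ig}\ge0$, where $M=\sum_{i\in N}\sum_{j\in R_i}p^i_ju^i_j$; (4) $\sum_{j\in R}a_jy^g_j\le\sum_{i\in N}b^iz_{ig}$; (5) $y^g_j=\sum_{i\in I_j}x^{i,g}_j$; (6) $B^ix^{i,g}\le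 d^iz_{ig}$; (7) $0\le x^{i,g}_j\le u^i_jz_{ig}$ for $i\in I_j$; (8) $y^g_j\le\sum_{i\in I_j}u^i_jz_{ig}$; (9) $z_{ig}=0$ whenever $i<g$; (10) $\sum_{i\in N}z_{ig}\le|N|z_{gg}$; (11) $v_i\ge0$, $\pi_g\ge 0$, $y^g_j\in\mathbb Z_+$, $z_{ig}\in\{0,1\}$; (12) only if $\alpha<1$: $w^g_j\in\{0,1\}$, $2w^g_j\le\sum_{i\in I_j}z_{ig}\le(|I_j|-1)w^g_j+1$, and $y^g_j\le\alpha\sum_{i\in I_j}u^i_jz_{ig}+M_j(1-w^g_j)$, where $M_j\ge(1-\alpha)\max_{i\in I_j}u^i_j$. $\mathcal F^{\mathrm{stab}}$ is the set of points of $\mathcal F$ satisfying, for all $g\in G$ and all $t\subseteq N$, $\sum_{i\in t}v_i\ge V(t)-M_t\bigl(|t|-\sum_{i\in t}z_{ig}\bigr)$, where $M_t\ge\max\{V(t),0\}$ are fixed constants. *)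

theory Defs
  imports "HOL-Analysis.Analysis"
begin

section \<open>Game data\<close>

text \<open>The private constraints of player \<open>i\<close> are the rows \<open>k < priv_rows G i\<close> of
  \<open>priv_mat G i\<close> with right-hand side \<open>priv_rhs G i\<close>. Fields that depend on an item or a player are
  meaningful only on \<open>items G\<close>, \<open>players G\<close> and, for a pair, when the item is available to the player.\<close>

record 'r game =
  num_players :: nat
  items :: "'r set"
  avail :: "'r \<Rightarrow> nat set"
  profit :: "nat \<Rightarrow> 'r \<Rightarrow> real"
  weight :: "'r \<Rightarrow> real"
  budget :: "nat \<Rightarrow> real"
  capacity :: "nat \<Rightarrow> 'r \<Rightarrow> real"
  priv_rows :: "nat \<Rightarrow> nat"
  priv_mat :: "nat \<Rightarrow> nat \<Rightarrow> 'r \<Rightarrow> real"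
  priv_rhs :: "nat \<Rightarrow> nat \<Rightarrow> real"
  pooling :: real

definition players :: "'r game \<Rightarrow> nat set" where
  "players G = {1..num_players G}"

abbreviation groups :: "'r game \<Rightarrow> nat set" where
  "groups G \<equiv> players G"

definition items_of :: "'r game \<Rightarrow> nat \<Rightarrow> 'r set" where
  "items_of G i = {j \<in> items G. i \<in> avail G j}"

definition game_data :: "'r game \<Rightarrow> bool" where
  "game_data G \<longleftrightarrow>
     finite (items G) \<and>
     (\<forall>j\<in>items G. avail G j \<subseteq> players G) \<and>
     (\<forall>j\<in>items G. \<forall>i\<in>avail G j. 0 \<le> profit G i j \<and> 0 \<le> capacity G i j) \<and>
     (\<forall>j\<in>items G. 0 < weight G j) \<and>
     0 < pooling G \<and> pooling G \<le> 1"

section \<open>The program of a coalition\<close>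

definition avail_in :: "'r game \<Rightarrow> nat set \<Rightarrow> 'r \<Rightarrow> nat set" where
  "avail_in G c j = avail G j \<inter> c"

definition coal_items :: "'r game \<Rightarrow> nat set \<Rightarrow> 'r set" where
  "coal_items G c = {j \<in> items G. avail_in G c j \<noteq> {}}"

definition ind_items :: "'r game \<Rightarrow> nat set \<Rightarrow> 'r set" where
  "ind_items G c = {j \<in> coal_items G c. card (avail_in G c j) = 1}"

definition com_items :: "'r game \<Rightarrow> nat set \<Rightarrow> 'r set" where
  "com_items G c = {j \<in> coal_items G c. card (avail_in G c j) \<ge> 2}"

definition private_ok :: "'r game \<Rightarrow> nat \<Rightarrow> ('r \<Rightarrow> real) \<Rightarrow> bool" where
  "private_ok G i xi \<longleftrightarrow>
     (\<forall>k<priv_rows G i. (\<Sum>j\<in>items_of G i. priv_mat G i k j * xi j) \<le> priv_rhs G i k)"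

definition coal_feasible ::
  "'r game \<Rightarrow> nat set \<Rightarrow> (nat \<Rightarrow> 'r \<Rightarrow> real) \<Rightarrow> ('r \<Rightarrow> real) \<Rightarrow> bool" where
  "coal_feasible G c x y \<longleftrightarrow>
     (\<Sum>j\<in>com_items G c. weight G j * y j)
       + (\<Sum>j\<in>ind_items G c. \<Sum>i\<in>avail_in G c j. weight G j * x i j) \<le> (\<Sum>i\<in>c. budget G i) \<and>
     (\<forall>j\<in>com_items G c. y j = (\<Sum>i\<in>avail_in G c j. x i j)) \<and>
     (\<forall>i\<in>c. private_ok G i (x i)) \<and>
     (\<forall>i\<in>c. \<forall>j\<in>items_of G i. 0 \<le> x i j \<and> x i j \<le> capacity G i j) \<and>
     (\<forall>j\<in>com_items G c. 0 \<le> y j \<and> y j \<le> pooling G * (\<Sum>i\<in>avail_in G c j. capacity G i j)) \<and>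
     (\<forall>j\<in>com_items G c. y j \<in> \<nat>) \<and>
     (\<forall>j\<in>ind_items G c. \<forall>i\<in>avail_in G c j. x i j \<in> \<nat>)"

definition coal_objective :: "'r game \<Rightarrow> nat set \<Rightarrow> (nat \<Rightarrow> 'r \<Rightarrow> real) \<Rightarrow> real" where
  "coal_objective G c x = (\<Sum>j\<in>coal_items G c. \<Sum>i\<in>avail_in G c j. profit G i j * x i j)"

definition coal_values :: "'r game \<Rightarrow> nat set \<Rightarrow> real set" where
  "coal_values G c = {coal_objective G c x | x y. coal_feasible G c x y}"

definition V :: "'r game \<Rightarrow> nat set \<Rightarrow> real" where
  "V G c = (if c = {} then 0 else (GREATEST r. r \<in> coal_values G c))"

text \<open>The last conjunct says that the private constraints do not tie the common items of a member
  of a coalition to the member's other decisions: recombining the common part of one privately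
  feasible plan with the remaining part of another is again privately feasible.\<close>

definition standing_assumptions :: "'r game \<Rightarrow> bool" where
  "standing_assumptions G \<longleftrightarrow>
     (\<forall>c\<subseteq>players G. \<exists>x y. coal_feasible G c x y) \<and>
     (\<forall>c\<subseteq>players G. bdd_above (coal_values G c)) \<and>
     (\<forall>c\<subseteq>players G. coal_feasible G c (\<lambda>i j. 0) (\<lambda>j. 0)) \<and>
     (\<forall>c\<subseteq>players G. \<forall>i\<in>c. \<forall>xi xi'. private_ok G i xi \<and> private_ok G i xi' \<longrightarrow>
        private_ok G i (\<lambda>j. if j \<in> com_items G c then xi j else xi' j))"

definition Delta :: "'r game \<Rightarrow> nat set \<Rightarrow> real" where
  "Delta G s = V G s - (\<Sum>i\<in>s. V G {i})"

text \<open>The maximum in the definition of \<^const>\<open>V\<close> is attained.\<close>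

lemma V_is_maximum:
  assumes G: "game_data G" and st: "standing_assumptions G"
    and c: "c \<subseteq> players G" "c \<noteq> {}"
  shows "V G c \<in> coal_values G c" and "\<And>r. r \<in> coal_values G c \<Longrightarrow> r \<le> V G c"
proof -
  define u where "u = (\<lambda>(i, j). if i \<in> c \<and> j \<in> items_of G i then capacity G i j else 0)"
  define Y where "Y = (\<lambda>f j. \<Sum>i\<in>avail_in G c j. f (i, j) :: real)"
  define D where "D = {f :: nat \<times> 'a \<Rightarrow> real. coal_feasible G c (curry f) (Y f)}"
  define K where "K = (\<Pi>\<^sub>E k\<in>UNIV. {0..u k}) \<inter> D"
  define obj where "obj = (\<lambda>f. coal_objective G c (curry f))"
  have cont: "continuous_on UNIV (\<lambda>f :: nat \<times> 'a \<Rightarrow> real. f k)" for k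
    by (rule continuous_on_product_coordinates)
  have contY: "continuous_on UNIV (\<lambda>f. Y f j)" for j
    unfolding Y_def by (intro continuous_intros cont)
  have clN: "closed {f. h f \<in> (\<nat> :: real set)}"
    if "continuous_on UNIV h" for h :: "(nat \<times> 'a \<Rightarrow> real) \<Rightarrow> real"
    using closed_vimage[OF closed_Nats that] by (simp add: vimage_def)
  have "closed D"
    unfolding D_def coal_feasible_def private_ok_def Ball_def curry_def
    by (intro closed_Collect_conj closed_Collect_all closed_Collect_imp open_Collect_const
        closed_Collect_le closed_Collect_eq clN continuous_intros cont contY)
  moreover have "compact (\<Pi>\<^sub>E k\<in>UNIV. {0..u k})"
    using compactin_PiE[of "\<lambda>_. euclidean" UNIV "\<lambda>k. {0..u k}"]
    by (simp add: euclidean_product_topology)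
  ultimately have cK: "compact K"
    unfolding K_def by (rule compact_Int_closed[rotated])
  have bnd: "i \<in> c \<and> j \<in> items_of G i" if "j \<in> coal_items G c" "i \<in> avail_in G c j" for i j
    using that by (auto simp: avail_in_def coal_items_def items_of_def)
  have subs: "com_items G c \<subseteq> coal_items G c" "ind_items G c \<subseteq> coal_items G c"
    by (auto simp: com_items_def ind_items_def)
  have val: "\<exists>f\<in>K. obj f = r" if "r \<in> coal_values G c" for r
  proof -
    obtain x y where xy: "coal_feasible G c x y" and r: "r = coal_objective G c x"
      using \<open>r \<in> coal_values G c\<close> by (auto simp: coal_values_def)
    define f where "f = (\<lambda>(i, j). if i \<in> c \<and> j \<in> items_of G i then x i j else 0)"
    have f1: "f (i, j) = x i j" if "i \<in> c" "j \<in> items_of G i" for i j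
      using that by (simp add: f_def)
    have f2: "f (i, j) = x i j" if "j \<in> coal_items G c" "i \<in> avail_in G c j" for i j
      using f1 bnd[OF that] by blast
    have f3: "f (i, j) = x i j" if "j \<in> ind_items G c" "i \<in> avail_in G c j" for i j
      using f2 subs that by blast
    have ysum: "(\<Sum>i\<in>avail_in G c j. x i j) = y j" if "j \<in> com_items G c" for j
      using xy that unfolding coal_feasible_def by simp
    have y: "Y f j = y j" if "j \<in> com_items G c" for j
    proof -
      have "j \<in> coal_items G c" using that subs by blast
      then have "Y f j = (\<Sum>i\<in>avail_in G c j. x i j)"
        unfolding Y_def by (simp add: f2 cong: sum.cong)
      then show ?thesis using ysum[OF that] by simp
    qed
    have yf: "(\<Sum>i\<in>avail_in G c j. f (i, j)) = y j" if "j \<in> com_items G c" for j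
      using y[OF that] unfolding Y_def .
    have pr: "private_ok G i (curry f i) = private_ok G i (x i)" if "i \<in> c" for i
      using that unfolding private_ok_def by (simp add: f1 cong: sum.cong)
    have "coal_feasible G c (curry f) (Y f)"
      using xy unfolding coal_feasible_def by (simp add: y ysum yf pr f1 f3 cong: sum.cong)
    moreover have "f \<in> (\<Pi>\<^sub>E k\<in>UNIV. {0..u k})"
      using xy unfolding coal_feasible_def by (auto simp: f_def u_def)
    moreover have "obj f = r"
      unfolding obj_def r coal_objective_def by (simp add: f2 cong: sum.cong)
    ultimately show ?thesis by (auto simp: K_def D_def)
  qed
  have K_val: "obj f \<in> coal_values G c" if "f \<in> K" for f
    using that by (auto simp: K_def D_def obj_def coal_values_def)
  have "coal_feasible G c (\<lambda>i j. 0) (\<lambda>j. 0)"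
    using st c(1) by (simp add: standing_assumptions_def)
  then have "coal_objective G c (\<lambda>i j. 0) \<in> coal_values G c"
    unfolding coal_values_def by blast
  then have "K \<noteq> {}" using val by blast
  moreover have "continuous_on K obj"
    unfolding obj_def coal_objective_def curry_def
    by (intro continuous_intros continuous_on_subset[OF cont]) auto
  ultimately obtain f where f: "f \<in> K" "\<And>h. h \<in> K \<Longrightarrow> obj h \<le> obj f"
    using continuous_attains_sup[OF cK] by blast
  have max: "r \<le> obj f" if "r \<in> coal_values G c" for r
    using val[OF that] f(2) by auto
  have "V G c = obj f"
    unfolding V_def using c(2) Greatest_equality[of "\<lambda>r. r \<in> coal_values G c", OF K_val[OF f(1)] max] by simp
  then show "V G c \<in> coal_values G c" and "\<And>r. r \<in> coal_values G c \<Longrightarrow> r \<le> V G c"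
    using K_val[OF f(1)] max by auto
qed

section \<open>The partition model and its stable points\<close>

text \<open>\<open>var_z P i g\<close>, \<open>var_phi P i g\<close>, \<open>var_x P i g j\<close>, \<open>var_y P g j\<close> and \<open>var_w P g j\<close> stand for
  $z_{ig}$, $\phi_{ig}$, $x^{i,g}_j$, $y^g_j$ and $w^g_j$.\<close>

record 'r point =
  var_v :: "nat \<Rightarrow> real"
  var_z :: "nat \<Rightarrow> nat \<Rightarrow> real"
  var_x :: "nat \<Rightarrow> nat \<Rightarrow> 'r \<Rightarrow> real"
  var_y :: "nat \<Rightarrow> 'r \<Rightarrow> real"
  var_pi :: "nat \<Rightarrow> real"
  var_phi :: "nat \<Rightarrow> nat \<Rightarrow> real"
  var_w :: "nat \<Rightarrow> 'r \<Rightarrow> real"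

definition big_M :: "'r game \<Rightarrow> real" where
  "big_M G = (\<Sum>i\<in>players G. \<Sum>j\<in>items_of G i. profit G i j * capacity G i j)"

text \<open>The constants \<open>Mj\<close> occur in the model only when the pooling parameter is below 1; the maximum
  over an item available to nobody is not defined and imposes nothing.\<close>

definition item_constants :: "'r game \<Rightarrow> ('r \<Rightarrow> real) \<Rightarrow> bool" where
  "item_constants G Mj \<longleftrightarrow>
     (pooling G < 1 \<longrightarrow>
        (\<forall>j\<in>items G. avail G j \<noteq> {} \<longrightarrow>
           Mj j \<ge> (1 - pooling G) * (MAX i\<in>avail G j. capacity G i j)))"

definition coalition_constants :: "'r game \<Rightarrow> (nat set \<Rightarrow> real) \<Rightarrow> bool" where
  "coalition_constants G Mt \<longleftrightarrow> (\<forall>t\<subseteq>players G. Mt t \<ge> max (V G t) 0)"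

definition pooling_constraints :: "'r game \<Rightarrow> ('r \<Rightarrow> real) \<Rightarrow> 'r point \<Rightarrow> bool" where
  "pooling_constraints G Mj P \<longleftrightarrow>
     (\<forall>g\<in>groups G. \<forall>j\<in>items G.
        var_w P g j \<in> {0, 1} \<and>
        2 * var_w P g j \<le> (\<Sum>i\<in>avail G j. var_z P i g) \<and>
        (\<Sum>i\<in>avail G j. var_z P i g) \<le> (real (card (avail G j)) - 1) * var_w P g j + 1 \<and>
        var_y P g j \<le> pooling G * (\<Sum>i\<in>avail G j. capacity G i j * var_z P i g)
                       + Mj j * (1 - var_w P g j))"

definition F :: "'r game \<Rightarrow> ('r \<Rightarrow> real) \<Rightarrow> 'r point set" where
  "F G Mj = {P.
     (\<forall>i\<in>players G. (\<Sum>g\<in>groups G. var_z P i g) = 1) \<and>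
     (\<forall>g\<in>groups G.
        var_pi P g = (\<Sum>j\<in>items G. \<Sum>i\<in>avail G j. profit G i j * var_x P i g j) \<and>
        var_pi P g = (\<Sum>i\<in>players G. var_phi P i g)) \<and>
     (\<forall>i\<in>players G. \<forall>g\<in>groups G.
        var_phi P i g \<le> var_v P i \<and>
        var_phi P i g \<le> big_M G * var_z P i g \<and>
        var_phi P i g \<ge> var_v P i - big_M G * (1 - var_z P i g) \<and>
        var_phi P i g \<ge> 0) \<and>
     (\<forall>g\<in>groups G.
        (\<Sum>j\<in>items G. weight G j * var_y P g j) \<le> (\<Sum>i\<in>players G. budget G i * var_z P i g)) \<and>
     (\<forall>g\<in>groups G. \<forall>j\<in>items G. var_y P g j = (\<Sum>i\<in>avail G j. var_x P i g j)) \<and>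
     (\<forall>i\<in>players G. \<forall>g\<in>groups G. \<forall>k<priv_rows G i.
        (\<Sum>j\<in>items_of G i. priv_mat G i k j * var_x P i g j) \<le> priv_rhs G i k * var_z P i g) \<and>
     (\<forall>g\<in>groups G. \<forall>j\<in>items G. \<forall>i\<in>avail G j.
        0 \<le> var_x P i g j \<and> var_x P i g j \<le> capacity G i j * var_z P i g) \<and>
     (\<forall>g\<in>groups G. \<forall>j\<in>items G.
        var_y P g j \<le> (\<Sum>i\<in>avail G j. capacity G i j * var_z P i g)) \<and>
     (\<forall>i\<in>players G. \<forall>g\<in>groups G. i < g \<longrightarrow> var_z P i g = 0) \<and>
     (\<forall>g\<in>groups G.
        (\<Sum>i\<in>players G. var_z P i g) \<le> real (card (players G)) * var_z P g g) \<and>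
     (\<forall>i\<in>players G. 0 \<le> var_v P i) \<and>
     (\<forall>g\<in>groups G. 0 \<le> var_pi P g) \<and>
     (\<forall>g\<in>groups G. \<forall>j\<in>items G. var_y P g j \<in> \<nat>) \<and>
     (\<forall>i\<in>players G. \<forall>g\<in>groups G. var_z P i g \<in> {0, 1}) \<and>
     (pooling G < 1 \<longrightarrow> pooling_constraints G Mj P)}"

definition F_stab :: "'r game \<Rightarrow> ('r \<Rightarrow> real) \<Rightarrow> (nat set \<Rightarrow> real) \<Rightarrow> 'r point set" where
  "F_stab G Mj Mt = {P \<in> F G Mj. \<forall>g\<in>groups G. \<forall>t\<subseteq>players G.
     (\<Sum>i\<in>t. var_v P i) \<ge> V G t - Mt t * (real (card t) - (\<Sum>i\<in>t. var_z P i g))}"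

end

theory Submission
  imports Defs
begin

text \<open>The \<open>var_z\<close> are binary, so two cases suffice. If all of \<open>s\<close>
  lies in group \<open>g\<close>, the factor of \<open>Delta G s\<close> is 1 and the right side
  collapses to \<open>V G s\<close>: the cut is the stability inequality for \<open>s\<close> with
  its big-M term switched off (\<open>F_stab_cut\<close>). If some member is outside, that factor is
  at most 0, and the remaining sum is dominated member by member via singleton stability and
  \<open>F_v_nonneg\<close>.\<close>

lemma F_stab_cut:
  assumes "P \<in> F_stab G Mj Mt" "g \<in> groups G" "t \<subseteq> players G"
    and "\<And>i. i \<in> t \<Longrightarrow> var_z P i g = 1"
  shows "V G t \<le> (\<Sum>i\<in>t. var_v P i)"
proof -
  have "V G t - Mt t * (real (card t) - (\<Sum>i\<in>t. var_z P i g)) \<le> (\<Sum>i\<in>t. var_v P i)"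
    using assms(1-3) by (auto simp: F_stab_def)
  then show ?thesis using assms(4) by simp
qed

lemma F_v_nonneg: "P \<in> F G Mj \<Longrightarrow> i \<in> players G \<Longrightarrow> 0 \<le> var_v P i"
  by (simp add: F_def)

lemma F_z_binary:
  "P \<in> F G Mj \<Longrightarrow> i \<in> players G \<Longrightarrow> g \<in> groups G \<Longrightarrow> var_z P i g = 0 \<or> var_z P i g = 1"
  by (simp add: F_def)

theorem proposition5:
  fixes G :: "'r game" and Mj :: "'r \<Rightarrow> real" and Mt :: "nat set \<Rightarrow> real"
    and s :: "nat set" and g :: nat and P :: "'r point"
  assumes "game_data G"
    and "standing_assumptions G"
    and "item_constants G Mj"
    and "coalition_constants G Mt"
    and "s \<subseteq> players G"
    and "Delta G s \<ge> 0"
    and "\<forall>i\<in>s. V G {i} \<ge> 0"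
    and "g \<in> groups G"
    and "P \<in> F_stab G Mj Mt"
  shows "(\<Sum>i\<in>s. var_v P i) \<ge>
           Delta G s * ((\<Sum>i\<in>s. var_z P i g) - real (card s) + 1)
             + (\<Sum>i\<in>s. V G {i} * var_z P i g)"
proof (cases "\<forall>i\<in>s. var_z P i g = 1")
  case True
  then show ?thesis
    using F_stab_cut[OF assms(9,8,5)] by (simp add: Delta_def)
next
  case False
  then obtain k where k: "k \<in> s" "var_z P k g \<noteq> 1" by blast
  have fin: "finite s"
    using assms(5) by (rule finite_subset) (simp add: players_def)
  have PF: "P \<in> F G Mj" using assms(9) by (simp add: F_stab_def)
  have z: "var_z P i g = 0 \<or> var_z P i g = 1" if "i \<in> s" for i
    using F_z_binary[OF PF _ assms(8)] assms(5) that by blast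
  \<comment> \<open>The outsider \<open>k\<close> contributes 0 and every other member at most 1, so
    the sum over \<open>s\<close> is at most \<open>card s - 1\<close>.\<close>
  have "(\<Sum>i\<in>s - {k}. var_z P i g) \<le> real (card (s - {k})) * 1"
    using z by (intro sum_bounded_above) force
  moreover have "real (card s) = real (card (s - {k})) + 1"
    using card.remove[OF fin k(1)] by simp
  ultimately have "(\<Sum>i\<in>s. var_z P i g) - real (card s) + 1 \<le> 0"
    using z[OF k(1)] k(2) sum.remove[OF fin k(1), of "\<lambda>i. var_z P i g"] by simp
  then have "Delta G s * ((\<Sum>i\<in>s. var_z P i g) - real (card s) + 1) \<le> 0"
    by (rule mult_nonneg_nonpos[OF assms(6)])
  moreover have "(\<Sum>i\<in>s. V G {i} * var_z P i g) \<le> (\<Sum>i\<in>s. var_v P i)"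
  proof (rule sum_mono)
    fix i assume i: "i \<in> s"
    then have ip: "i \<in> players G" using assms(5) by blast
    show "V G {i} * var_z P i g \<le> var_v P i"
      \<comment> \<open>Value 0 of \<open>var_z P i g\<close> leaves nonnegativity of
        \<open>var_v P i\<close>; value 1 activates the stability inequality of \<open>{i}\<close>
        in group \<open>g\<close>.\<close>
      using z[OF i] F_stab_cut[OF assms(9,8), of "{i}"] F_v_nonneg[OF PF ip] ip by auto
  qed
  ultimately show ?thesis by linarith
qed

end
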